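(* For all $j\le n<\omega$ and every formula $\varphi$ of $\mathsf{GLP}_\omega$, \[\langle n+1\rangle\varphi\ \equiv_j\ \{\langle j\rangle(\varphi\wedge Q^k_n(\varphi))\mid k<\omega\}.\]
   Context: $\mathsf{GLP}_\omega$ is the propositional polymodal logic with modalities $[m]$, $m<\omega$ ($\langle m\rangle:=\neg[m]\neg$), axiomatized by propositional tautologies; $[m](\varphi\to\psi)\to([m]\varphi\to[m]\psi)$; $[m]\varphi\to[m][m]\varphi$; $[m]([m]\varphi\to\varphi)\to[m]\varphi$; $\langle l\rangle\varphi\to\langle m\rangle\varphi$ and $\langle m\rangle\varphi\to[l]\langle m\rangle\varphi$ for $m<l$; rules modus ponens and necessitation for each $[m]$. $Q^0_n(\varphi)=\top$, $Q^{k+1}_n(\varphi)=\langle n\rangle(\varphi\wedge Q^k_n(\varphi))$. For sets of formulas $\tau,\sigma$ (a single formula being identified with a singleton), $\tau\vdash\chi$ means some finite conjunction of members of $\tau$ provably implies $\chi$ in $\mathsf{GLP}_\omega$, and $\tau\equiv_j\sigma$ means: for every formula $\chi$, $\tau\vdash\langle j\rangle\chi$ iff $\sigma\vdash\langle j\rangle\chi$. *)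

theory Defs
  imports Main
begin

text \<open>
  Falsum, implication and the boxes are primitive; the remaining connectives are the usual
  classical abbreviations. There are countably many propositional variables.
\<close>

datatype fm =
    Var nat
  | Bot
  | Imp fm fm  (infixr "\<rightarrow>\<^sub>f" 55)
  | Box nat fm

abbreviation Neg :: "fm \<Rightarrow> fm" where
  "Neg \<phi> \<equiv> \<phi> \<rightarrow>\<^sub>f Bot"

abbreviation Top :: fm where
  "Top \<equiv> Neg Bot"

abbreviation And :: "fm \<Rightarrow> fm \<Rightarrow> fm"  (infixr "\<and>\<^sub>f" 65) where
  "\<phi> \<and>\<^sub>f \<psi> \<equiv> Neg (\<phi> \<rightarrow>\<^sub>f Neg \<psi>)"

abbreviation Dia :: "nat \<Rightarrow> fm \<Rightarrow> fm" where
  "Dia m \<phi> \<equiv> Neg (Box m (Neg \<phi>))"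

text \<open>
  Propositional evaluation treats variables and boxed formulas alike as atoms, so that
  \<open>tautology\<close> describes exactly the substitution instances of classical tautologies.
\<close>

primrec truth :: "(fm \<Rightarrow> bool) \<Rightarrow> fm \<Rightarrow> bool" where
  "truth v (Var p) \<longleftrightarrow> v (Var p)"
| "truth v Bot \<longleftrightarrow> False"
| "truth v (\<phi> \<rightarrow>\<^sub>f \<psi>) \<longleftrightarrow> (truth v \<phi> \<longrightarrow> truth v \<psi>)"
| "truth v (Box m \<phi>) \<longleftrightarrow> v (Box m \<phi>)"

definition tautology :: "fm \<Rightarrow> bool" where
  "tautology \<phi> \<longleftrightarrow> (\<forall>v. truth v \<phi>)"

inductive GLP :: "fm \<Rightarrow> bool" where
  taut: "tautology \<phi> \<Longrightarrow> GLP \<phi>"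
| dist: "GLP (Box m (\<phi> \<rightarrow>\<^sub>f \<psi>) \<rightarrow>\<^sub>f Box m \<phi> \<rightarrow>\<^sub>f Box m \<psi>)"
| trans: "GLP (Box m \<phi> \<rightarrow>\<^sub>f Box m (Box m \<phi>))"
| loeb: "GLP (Box m (Box m \<phi> \<rightarrow>\<^sub>f \<phi>) \<rightarrow>\<^sub>f Box m \<phi>)"
| mono: "m < l \<Longrightarrow> GLP (Dia l \<phi> \<rightarrow>\<^sub>f Dia m \<phi>)"
| dia_box: "m < l \<Longrightarrow> GLP (Dia m \<phi> \<rightarrow>\<^sub>f Box l (Dia m \<phi>))"
| mp: "GLP (\<phi> \<rightarrow>\<^sub>f \<psi>) \<Longrightarrow> GLP \<phi> \<Longrightarrow> GLP \<psi>"
| nec: "GLP \<phi> \<Longrightarrow> GLP (Box m \<phi>)"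

primrec conj_list :: "fm list \<Rightarrow> fm" where
  "conj_list [] = Top"
| "conj_list (\<phi> # \<phi>s) = \<phi> \<and>\<^sub>f conj_list \<phi>s"

text \<open>Necessitation applies to theorems only, not to members of \<open>\<tau>\<close>.\<close>

definition derives :: "fm set \<Rightarrow> fm \<Rightarrow> bool"  (infix "\<turnstile>" 50) where
  "\<tau> \<turnstile> \<chi> \<longleftrightarrow> (\<exists>\<phi>s. set \<phi>s \<subseteq> \<tau> \<and> GLP (conj_list \<phi>s \<rightarrow>\<^sub>f \<chi>))"

definition equiv_dia :: "nat \<Rightarrow> fm set \<Rightarrow> fm set \<Rightarrow> bool" where
  "equiv_dia j \<tau> \<sigma> \<longleftrightarrow> (\<forall>\<chi>. \<tau> \<turnstile> Dia j \<chi> \<longleftrightarrow> \<sigma> \<turnstile> Dia j \<chi>)"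

primrec Q :: "nat \<Rightarrow> nat \<Rightarrow> fm \<Rightarrow> fm" where
  "Q n 0 \<phi> = Top"
| "Q n (Suc k) \<phi> = Dia n (\<phi> \<and>\<^sub>f Q n k \<phi>)"

end

theory Submission
  imports Defs
begin

text \<open>
  The hard direction turns a proof of \<open>Dia (n + 1) \<phi> \<rightarrow>\<^sub>f Dia j \<chi>\<close> into a bound on \<open>k\<close>. Let \<open>t\<close> be a
  maximal consistent set, and imagine a new point whose \<open>m\<close>-successors are those of \<open>t\<close>
  for \<open>m \<le> n\<close>, whose \<open>n + 1\<close>-successors are \<open>t\<close> itself together with those of \<open>t\<close>, and
  which has no successors of higher level. All axioms hold at this point, except that an instance
  \<open>Dia (n + 1) \<alpha> \<rightarrow>\<^sub>f Dia m \<alpha>\<close> requires \<open>t\<close> to satisfy the reflection principle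
  \<open>Box n (Neg \<alpha>) \<rightarrow>\<^sub>f Neg \<alpha>\<close>. A given proof uses only finitely many such instances. Along a chain of
  \<open>n\<close>-successors each failure of reflection adds a new box to those already true, so a chain
  longer than the number of instances, which is what \<open>Q n k \<phi>\<close> provides, reaches a \<open>t\<close>
  containing \<open>\<phi>\<close> and satisfying them all; at the new point \<open>Dia (n + 1) \<phi>\<close> is true, and
  \<open>Dia j \<chi>\<close> is inherited from \<open>t\<close>.
\<close>

section \<open>Theories and maximal consistent sets\<close>

definition glp_theory :: "fm set \<Rightarrow> bool" where
  "glp_theory T \<longleftrightarrow> Collect GLP \<subseteq> T \<and> (\<forall>\<phi> \<psi>. (\<phi> \<rightarrow>\<^sub>f \<psi>) \<in> T \<longrightarrow> \<phi> \<in> T \<longrightarrow> \<psi> \<in> T)"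

definition mcs :: "fm set \<Rightarrow> bool" where
  "mcs x \<longleftrightarrow> glp_theory x \<and> Bot \<notin> x \<and> (\<forall>\<phi>. \<phi> \<in> x \<or> Neg \<phi> \<in> x)"

lemma GLP_in_theory: "glp_theory T \<Longrightarrow> GLP \<phi> \<Longrightarrow> \<phi> \<in> T"
  by (auto simp: glp_theory_def)

lemma theory_mp: "glp_theory T \<Longrightarrow> (\<phi> \<rightarrow>\<^sub>f \<psi>) \<in> T \<Longrightarrow> \<phi> \<in> T \<Longrightarrow> \<psi> \<in> T"
  by (auto simp: glp_theory_def)

text \<open>The deduction theorem in disguise: these are the consequences of \<open>T\<close> with
  \<open>\<phi>\<close> added as an assumption, and two tautologies give the closure.\<close>

lemma theory_extend:
  assumes T: "glp_theory T"
  shows "glp_theory {\<chi>. (\<phi> \<rightarrow>\<^sub>f \<chi>) \<in> T}"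
  unfolding glp_theory_def
proof (intro conjI allI impI subsetI)
  fix \<chi> assume "\<chi> \<in> Collect GLP"
  moreover have "GLP (\<chi> \<rightarrow>\<^sub>f \<phi> \<rightarrow>\<^sub>f \<chi>)"
    by (rule taut) (simp add: tautology_def)
  ultimately show "\<chi> \<in> {\<chi>. (\<phi> \<rightarrow>\<^sub>f \<chi>) \<in> T}"
    using GLP_in_theory[OF T] mp by blast
next
  fix \<chi> \<psi> assume "(\<chi> \<rightarrow>\<^sub>f \<psi>) \<in> {\<chi>. (\<phi> \<rightarrow>\<^sub>f \<chi>) \<in> T}" "\<chi> \<in> {\<chi>. (\<phi> \<rightarrow>\<^sub>f \<chi>) \<in> T}"
  moreover have "GLP ((\<phi> \<rightarrow>\<^sub>f \<chi> \<rightarrow>\<^sub>f \<psi>) \<rightarrow>\<^sub>f (\<phi> \<rightarrow>\<^sub>f \<chi>) \<rightarrow>\<^sub>f \<phi> \<rightarrow>\<^sub>f \<psi>)"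
    by (rule taut) (simp add: tautology_def)
  ultimately show "\<psi> \<in> {\<chi>. (\<phi> \<rightarrow>\<^sub>f \<chi>) \<in> T}"
    using GLP_in_theory[OF T] theory_mp[OF T] by blast
qed

lemma subset_extend:
  assumes T: "glp_theory T"
  shows "T \<subseteq> {\<chi>. (\<phi> \<rightarrow>\<^sub>f \<chi>) \<in> T}"
proof
  fix \<chi> assume "\<chi> \<in> T"
  moreover have "GLP (\<chi> \<rightarrow>\<^sub>f \<phi> \<rightarrow>\<^sub>f \<chi>)"
    by (rule taut) (simp add: tautology_def)
  ultimately show "\<chi> \<in> {\<chi>. (\<phi> \<rightarrow>\<^sub>f \<chi>) \<in> T}"
    using GLP_in_theory[OF T] theory_mp[OF T] by blast
qed

lemma theory_Union_chain:
  assumes ch: "subset.chain {T. glp_theory T \<and> P T} C" and ne: "C \<noteq> {}"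
  shows "glp_theory (\<Union>C)"
proof -
  have C: "glp_theory T" if "T \<in> C" for T
    using ch that by (auto simp: subset_chain_def)
  have comparable: "S \<subseteq> T \<or> T \<subseteq> S" if "S \<in> C" "T \<in> C" for S T
    using ch that by (auto simp: subset_chain_def)
  show ?thesis
    unfolding glp_theory_def
  proof (intro conjI allI impI)
    show "Collect GLP \<subseteq> \<Union>C"
      using ne C GLP_in_theory by blast
    fix \<phi> \<psi> assume "(\<phi> \<rightarrow>\<^sub>f \<psi>) \<in> \<Union>C" "\<phi> \<in> \<Union>C"
    then obtain S T where "S \<in> C" "T \<in> C" "(\<phi> \<rightarrow>\<^sub>f \<psi>) \<in> S" "\<phi> \<in> T"
      by blast
    then show "\<psi> \<in> \<Union>C"
      using comparable[of S T] C theory_mp by blast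
  qed
qed

lemma lindenbaum:
  assumes T: "glp_theory T" and "\<phi> \<notin> T"
  obtains x where "mcs x" "T \<subseteq> x" "\<phi> \<notin> x"
proof -
  define U where "U = {\<chi>. (Neg \<phi> \<rightarrow>\<^sub>f \<chi>) \<in> T}"
  define A where "A = {S. glp_theory S \<and> U \<subseteq> S \<and> Bot \<notin> S}"
  have dn: "GLP (Neg (Neg \<phi>) \<rightarrow>\<^sub>f \<phi>)"
    by (rule taut) (simp add: tautology_def)
  have "GLP (Neg \<phi> \<rightarrow>\<^sub>f Neg \<phi>)"
    by (rule taut) (simp add: tautology_def)
  then have neg: "Neg \<phi> \<in> U"
    using GLP_in_theory[OF T] by (simp add: U_def)
  \<comment> \<open>\<open>Bot\<close> in \<open>U\<close> would mean that the double negation of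
    \<open>\<phi>\<close>, hence \<open>\<phi>\<close> itself, is in \<open>T\<close>.\<close>
  have "Bot \<notin> U"
    using \<open>\<phi> \<notin> T\<close> theory_mp[OF T] GLP_in_theory[OF T dn] by (auto simp: U_def)
  then have "U \<in> A"
    using theory_extend[OF T] by (simp add: A_def U_def)
  then have "A \<noteq> {}" by blast
  moreover have "\<Union>C \<in> A" if "C \<noteq> {}" "subset.chain A C" for C
  proof -
    have "C \<subseteq> A"
      using that by (simp add: subset_chain_def)
    then show ?thesis
      using theory_Union_chain[of "\<lambda>S. U \<subseteq> S \<and> Bot \<notin> S" C] that by (auto simp: A_def)
  qed
  ultimately obtain x where x: "x \<in> A" and max: "\<And>S. S \<in> A \<Longrightarrow> x \<subseteq> S \<Longrightarrow> S = x"
    using subset_Zorn_nonempty[of A] by blast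
  have th: "glp_theory x" and "U \<subseteq> x" "Bot \<notin> x"
    using x by (auto simp: A_def)
  have "Neg \<psi> \<in> x" if "\<psi> \<notin> x" for \<psi>
  proof (rule ccontr)
    assume n: "Neg \<psi> \<notin> x"
    let ?S = "{\<chi>. (\<psi> \<rightarrow>\<^sub>f \<chi>) \<in> x}"
    \<comment> \<open>Consistency of the extension is exactly the assumption \<open>n\<close>, since
      \<open>Bot\<close> in \<open>?S\<close> unfolds to \<open>Neg \<psi>\<close> in
      \<open>x\<close>.\<close>
    have "?S \<in> A"
      using n theory_extend[OF th] subset_extend[OF th] \<open>U \<subseteq> x\<close> unfolding A_def by blast
    then have "?S = x"
      using max subset_extend[OF th] by blast
    moreover have "\<psi> \<in> ?S"
      using GLP_in_theory[OF th] taut by (simp add: tautology_def)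
    ultimately show False
      using that by blast
  qed
  then have "mcs x"
    using th \<open>Bot \<notin> x\<close> by (auto simp: mcs_def)
  moreover have "T \<subseteq> x"
    using subset_extend[OF T] \<open>U \<subseteq> x\<close> by (auto simp: U_def)
  moreover have "\<phi> \<notin> x"
    using neg \<open>U \<subseteq> x\<close> \<open>Bot \<notin> x\<close> theory_mp[OF th] by blast
  ultimately show ?thesis
    by (rule that)
qed

lemma GLP_in_mcs: "mcs x \<Longrightarrow> GLP \<phi> \<Longrightarrow> \<phi> \<in> x"
  by (simp add: mcs_def GLP_in_theory)

lemma mcs_Bot: "mcs x \<Longrightarrow> Bot \<notin> x"
  by (simp add: mcs_def)

lemma mcs_Imp:
  assumes "mcs x"
  shows "(\<phi> \<rightarrow>\<^sub>f \<psi>) \<in> x \<longleftrightarrow> (\<phi> \<in> x \<longrightarrow> \<psi> \<in> x)"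
proof -
  have th: "glp_theory x"
    using assms by (simp add: mcs_def)
  have "GLP (Neg \<phi> \<rightarrow>\<^sub>f \<phi> \<rightarrow>\<^sub>f \<psi>)" "GLP (\<psi> \<rightarrow>\<^sub>f \<phi> \<rightarrow>\<^sub>f \<psi>)"
    by (auto intro!: taut simp: tautology_def)
  then have "(Neg \<phi> \<rightarrow>\<^sub>f \<phi> \<rightarrow>\<^sub>f \<psi>) \<in> x" "(\<psi> \<rightarrow>\<^sub>f \<phi> \<rightarrow>\<^sub>f \<psi>) \<in> x"
    using GLP_in_theory[OF th] by auto
  moreover have "\<phi> \<in> x \<or> Neg \<phi> \<in> x"
    using assms by (simp add: mcs_def)
  ultimately show ?thesis
    using theory_mp[OF th] by blast
qed

lemmas mcs_simps = mcs_Bot mcs_Imp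

text \<open>Lindenbaum applied to the set of theorems. It lets provability be checked pointwise
  below.\<close>

lemma GLP_iff_mcs: "GLP \<phi> \<longleftrightarrow> (\<forall>x. mcs x \<longrightarrow> \<phi> \<in> x)"
proof
  assume all: "\<forall>x. mcs x \<longrightarrow> \<phi> \<in> x"
  have "glp_theory (Collect GLP)"
    using mp by (auto simp: glp_theory_def)
  then show "GLP \<phi>"
    using all lindenbaum[of "Collect GLP" \<phi>] by blast
qed (simp add: GLP_in_mcs)

lemma mcs_conj_list: "mcs x \<Longrightarrow> conj_list \<phi>s \<in> x \<longleftrightarrow> set \<phi>s \<subseteq> x"
  by (induction \<phi>s) (auto simp: mcs_simps)

section \<open>Boxes and diamonds at maximal consistent sets\<close>

lemma mcs_Box_mp: "mcs x \<Longrightarrow> Box m (\<phi> \<rightarrow>\<^sub>f \<psi>) \<in> x \<Longrightarrow> Box m \<phi> \<in> x \<Longrightarrow> Box m \<psi> \<in> x"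
  using GLP_in_mcs[OF _ dist[of m \<phi> \<psi>]] by (simp add: mcs_simps)

lemma mcs_Box_imp:
  assumes "mcs x" and "GLP (\<phi> \<rightarrow>\<^sub>f \<psi>)" and "Box m \<phi> \<in> x"
  shows "Box m \<psi> \<in> x"
  using assms GLP_in_mcs nec mcs_Box_mp by blast

lemma mcs_Box_trans: "mcs x \<Longrightarrow> Box m \<phi> \<in> x \<Longrightarrow> Box m (Box m \<phi>) \<in> x"
  using GLP_in_mcs[OF _ trans[of m \<phi>]] by (simp add: mcs_simps)

lemma mcs_Dia_mono: "mcs x \<Longrightarrow> m \<le> l \<Longrightarrow> Dia l \<phi> \<in> x \<Longrightarrow> Dia m \<phi> \<in> x"
  using GLP_in_mcs[OF _ mono[of m l \<phi>]] by (cases "m = l") (auto simp: mcs_simps)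

lemma mcs_Box_mono:
  assumes x: "mcs x" and "m \<le> l" and "Box m \<phi> \<in> x"
  shows "Box l \<phi> \<in> x"
proof -
  \<comment> \<open>The axiom compares diamonds, so its contrapositive only moves boxes of
    negations; double negations bridge the gap.\<close>
  have "GLP (\<phi> \<rightarrow>\<^sub>f Neg (Neg \<phi>))" "GLP (Neg (Neg \<phi>) \<rightarrow>\<^sub>f \<phi>)"
    by (auto intro!: taut simp: tautology_def)
  moreover have "Box m (Neg (Neg \<phi>)) \<in> x \<Longrightarrow> Box l (Neg (Neg \<phi>)) \<in> x"
    using mcs_Dia_mono[OF x \<open>m \<le> l\<close>, of "Neg \<phi>"] x by (auto simp: mcs_simps)
  ultimately show ?thesis
    using mcs_Box_imp[OF x] \<open>Box m \<phi> \<in> x\<close> by blast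
qed

text \<open>The formulas boxed at \<open>x\<close> form a theory by necessitation and distribution,
  so Lindenbaum supplies the successor.\<close>

lemma mcs_Box_successor:
  assumes x: "mcs x" and "Box m \<phi> \<notin> x"
  obtains y where "mcs y" "\<And>\<psi>. Box m \<psi> \<in> x \<Longrightarrow> \<psi> \<in> y" "\<phi> \<notin> y"
proof -
  have "glp_theory {\<psi>. Box m \<psi> \<in> x}"
    using GLP_in_mcs[OF x] nec mcs_Box_mp[OF x] unfolding glp_theory_def by blast
  moreover have "\<phi> \<notin> {\<psi>. Box m \<psi> \<in> x}"
    using \<open>Box m \<phi> \<notin> x\<close> by simp
  ultimately obtain y where "mcs y" "{\<psi>. Box m \<psi> \<in> x} \<subseteq> y" "\<phi> \<notin> y"
    by (rule lindenbaum)
  then show ?thesis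
    by (intro that) auto
qed

lemma mcs_Dia_successor:
  assumes "mcs x" and "Dia m \<phi> \<in> x"
  obtains y where "mcs y" "\<And>\<psi>. Box m \<psi> \<in> x \<Longrightarrow> \<psi> \<in> y" "\<phi> \<in> y"
proof -
  have "Box m (Neg \<phi>) \<notin> x"
    using assms by (simp add: mcs_simps)
  with \<open>mcs x\<close> obtain y where "mcs y" "\<And>\<psi>. Box m \<psi> \<in> x \<Longrightarrow> \<psi> \<in> y" "Neg \<phi> \<notin> y"
    using mcs_Box_successor by blast
  then show ?thesis
    using that by (simp add: mcs_simps)
qed

lemma mcs_Dia_intro:
  assumes "mcs x" and "Box m \<psi> \<in> x" and "Dia m \<phi> \<in> x"
  shows "Dia m (\<phi> \<and>\<^sub>f \<psi>) \<in> x"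
proof -
  have "GLP (\<psi> \<rightarrow>\<^sub>f Neg (\<phi> \<and>\<^sub>f \<psi>) \<rightarrow>\<^sub>f Neg \<phi>)"
    by (rule taut) (simp add: tautology_def)
  then have "Box m (Neg (\<phi> \<and>\<^sub>f \<psi>) \<rightarrow>\<^sub>f Neg \<phi>) \<in> x"
    using mcs_Box_imp assms by blast
  then show ?thesis
    using assms mcs_Box_mp[of x m "Neg (\<phi> \<and>\<^sub>f \<psi>)" "Neg \<phi>"] by (auto simp: mcs_simps)
qed

text \<open>The core of the easy direction. Lowering the diamond to level \<open>n\<close> yields
  the next \<open>Q\<close>, which is a diamond of lower level and so gets boxed at
  \<open>Suc n\<close> by \<open>dia_box\<close>; it can then be put under the original
  diamond.\<close>

lemma mcs_Dia_Suc_Q: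
  assumes x: "mcs x" and d: "Dia (Suc n) \<phi> \<in> x"
  shows "Dia (Suc n) (\<phi> \<and>\<^sub>f Q n k \<phi>) \<in> x"
proof (induction k)
  case 0
  have "Box (Suc n) Top \<in> x"
    by (intro GLP_in_mcs x nec taut) (simp add: tautology_def)
  then show ?case
    using mcs_Dia_intro[OF x] d by simp
next
  case (Suc k)
  have "Dia n (\<phi> \<and>\<^sub>f Q n k \<phi>) \<in> x"
    using mcs_Dia_mono[OF x _ Suc] by simp
  then have "Box (Suc n) (Q n (Suc k) \<phi>) \<in> x"
    using GLP_in_mcs[OF x dia_box[of n "Suc n" "\<phi> \<and>\<^sub>f Q n k \<phi>"]] x by (simp add: mcs_simps)
  then show ?case
    using mcs_Dia_intro[OF x] d by blast
qed

section \<open>The new point and chains of successors\<close>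

text \<open>The valuation of the imagined point above \<open>t\<close>.\<close>

definition above :: "nat \<Rightarrow> fm set \<Rightarrow> fm \<Rightarrow> bool" where
  "above n t \<alpha> \<longleftrightarrow> (case \<alpha> of
     Box m \<phi> \<Rightarrow> (m \<le> n \<longrightarrow> Box m \<phi> \<in> t) \<and> (m = Suc n \<longrightarrow> \<phi> \<in> t \<and> Box m \<phi> \<in> t)
   | _ \<Rightarrow> False)"

lemma above_Box:
  "above n t (Box m \<phi>) \<longleftrightarrow>
     (m \<le> n \<longrightarrow> Box m \<phi> \<in> t) \<and> (m = Suc n \<longrightarrow> \<phi> \<in> t \<and> Box m \<phi> \<in> t)"
  by (simp add: above_def)

text \<open>\<open>D\<close> collects the reflection instances that the proof of
  \<open>\<theta>\<close> calls for. Only \<open>mono\<close> contributes one, and modus ponens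
  takes unions.\<close>

lemma GLP_sound_above:
  assumes "GLP \<theta>"
  shows "\<exists>D. finite D \<and> (\<forall>t. mcs t \<longrightarrow> (\<forall>\<psi>\<in>D. Box n \<psi> \<in> t \<longrightarrow> \<psi> \<in> t) \<longrightarrow> truth (above n t) \<theta>)"
  using assms
proof (induction rule: GLP.induct)
  case (taut \<phi>)
  then show ?case by (auto simp: tautology_def)
next
  case (dist m \<phi> \<psi>)
  show ?case
    by (rule exI[of _ "{}"]) (auto simp: above_Box mcs_simps intro: mcs_Box_mp)
next
  case (trans m \<phi>)
  show ?case
    by (rule exI[of _ "{}"]) (auto simp: above_Box intro: mcs_Box_trans)
next
  case (loeb m \<phi>)
  have "Box m \<phi> \<in> t" if "mcs t" "Box m (Box m \<phi> \<rightarrow>\<^sub>f \<phi>) \<in> t" for t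
    \<comment> \<open>At level \<open>Suc n\<close>, \<open>t\<close> itself is a successor and
      contains the implication, so \<open>Box m \<phi>\<close> in \<open>t\<close> gives
      \<open>\<phi>\<close> in \<open>t\<close>.\<close>
    using GLP_in_mcs[OF that(1) GLP.loeb[of m \<phi>]] that by (simp add: mcs_simps)
  then show ?case
    by (intro exI[of _ "{}"]) (auto simp: above_Box mcs_simps)
next
  case (mono m l \<phi>)
  \<comment> \<open>The critical case is \<open>l = Suc n\<close>: \<open>Box m (Neg \<phi>)\<close>
    in \<open>t\<close> rises to level \<open>n\<close>, and reflection then puts
    \<open>Neg \<phi>\<close> into \<open>t\<close>, as the new successor \<open>t\<close> demands.
    Above \<open>Suc n\<close> boxes hold vacuously.\<close>
  have "truth (above n t) (Dia l \<phi> \<rightarrow>\<^sub>f Dia m \<phi>)"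
    if t: "mcs t" and refl: "Box n (Neg \<phi>) \<in> t \<Longrightarrow> Neg \<phi> \<in> t" for t
    using mono refl mcs_Box_mono[OF t, of m n "Neg \<phi>"] mcs_Box_mono[OF t, of m l "Neg \<phi>"]
    by (auto simp: above_Box)
  then show ?case
    by (intro exI[of _ "{Neg \<phi>}"]) blast
next
  case (dia_box m l \<phi>)
  have "Box l (Dia m \<phi>) \<in> t" if "mcs t" "Box m (Neg \<phi>) \<notin> t" for t
    using GLP_in_mcs[OF that(1) GLP.dia_box[OF dia_box, of \<phi>]] that by (simp add: mcs_simps)
  then show ?case
    using dia_box by (intro exI[of _ "{}"]) (auto simp: above_Box mcs_simps)
next
  case (mp \<phi> \<psi>)
  then obtain D E where
    "finite D" "\<And>t. mcs t \<Longrightarrow> \<forall>\<psi>\<in>D. Box n \<psi> \<in> t \<longrightarrow> \<psi> \<in> t \<Longrightarrow> truth (above n t) (\<phi> \<rightarrow>\<^sub>f \<psi>)"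
    "finite E" "\<And>t. mcs t \<Longrightarrow> \<forall>\<psi>\<in>E. Box n \<psi> \<in> t \<longrightarrow> \<psi> \<in> t \<Longrightarrow> truth (above n t) \<phi>"
    by blast
  then show ?case
    by (intro exI[of _ "D \<union> E"]) auto
next
  case (nec \<phi> m)
  then show ?case
    \<comment> \<open>Boxes are evaluated by membership in \<open>t\<close>, which contains all
      theorems.\<close>
    by (intro exI[of _ "{}"]) (auto simp: above_Box intro: GLP_in_mcs GLP.nec)
qed

text \<open>Each step down the chain either reaches a reflecting point or lowers the number of
  members of \<open>D\<close> not yet boxed; \<open>k\<close> exceeds that number, so the chain
  cannot run out first.\<close>

lemma Q_reflecting_successor:
  assumes "finite D"
    and "mcs x" and "Q n k \<phi> \<in> x" and "card {\<psi> \<in> D. Box n \<psi> \<notin> x} < k"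
  shows "\<exists>t. mcs t \<and> (\<forall>\<psi>. Box n \<psi> \<in> x \<longrightarrow> Box n \<psi> \<in> t \<and> \<psi> \<in> t) \<and> \<phi> \<in> t \<and>
           (\<forall>\<psi>\<in>D. Box n \<psi> \<in> t \<longrightarrow> \<psi> \<in> t)"
  using assms(2-)
proof (induction k arbitrary: x)
  case 0
  then show ?case by simp
next
  case (Suc k)
  then have "Dia n (\<phi> \<and>\<^sub>f Q n k \<phi>) \<in> x"
    by simp
  with \<open>mcs x\<close> obtain y where y: "mcs y" and succ: "\<And>\<psi>. Box n \<psi> \<in> x \<Longrightarrow> \<psi> \<in> y"
    and "\<phi> \<and>\<^sub>f Q n k \<phi> \<in> y"
    using mcs_Dia_successor by blast
  then have "\<phi> \<in> y" "Q n k \<phi> \<in> y"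
    by (simp_all add: mcs_simps)
  have boxes: "Box n \<psi> \<in> y" if "Box n \<psi> \<in> x" for \<psi>
    using succ mcs_Box_trans[OF \<open>mcs x\<close> that] by blast
  show ?case
  proof (cases "\<forall>\<psi>\<in>D. Box n \<psi> \<in> y \<longrightarrow> \<psi> \<in> y")
    case True
    then show ?thesis
      using y succ boxes \<open>\<phi> \<in> y\<close> by blast
  next
    case False
    then obtain \<psi> where \<psi>: "\<psi> \<in> D" "Box n \<psi> \<in> y" "\<psi> \<notin> y"
      by blast
    \<comment> \<open>The failing \<open>\<psi>\<close> is boxed at \<open>y\<close> but not at
      \<open>x\<close>, for otherwise the successor \<open>y\<close> would contain it.\<close>
    then have "{\<psi> \<in> D. Box n \<psi> \<notin> y} \<subset> {\<psi> \<in> D. Box n \<psi> \<notin> x}"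
      using boxes succ by blast
    then have "card {\<psi> \<in> D. Box n \<psi> \<notin> y} < card {\<psi> \<in> D. Box n \<psi> \<notin> x}"
      using \<open>finite D\<close> by (simp add: psubset_card_mono)
    then have "card {\<psi> \<in> D. Box n \<psi> \<notin> y} < k"
      using Suc.prems by linarith
    then show ?thesis
      using Suc.IH[OF y \<open>Q n k \<phi> \<in> y\<close>] boxes succ by blast
  qed
qed

lemma Dia_Suc_reduction:
  assumes "j \<le> n" and prov: "GLP (Dia (Suc n) \<phi> \<rightarrow>\<^sub>f Dia j \<chi>)"
  shows "\<exists>k. GLP (Dia j (\<phi> \<and>\<^sub>f Q n k \<phi>) \<rightarrow>\<^sub>f Dia j \<chi>)"
proof -
  obtain D where D: "finite D"
    and sound: "\<And>t. mcs t \<Longrightarrow> \<forall>\<psi>\<in>D. Box n \<psi> \<in> t \<longrightarrow> \<psi> \<in> t \<Longrightarrow>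
                  truth (above n t) (Dia (Suc n) \<phi> \<rightarrow>\<^sub>f Dia j \<chi>)"
    using GLP_sound_above[OF prov] by blast
  \<comment> \<open>All of \<open>D\<close> may be unboxed at the start, and the bound needed is
    strict.\<close>
  let ?k = "Suc (card D)"
  have "Dia j \<chi> \<in> x" if x: "mcs x" and d: "Dia j (\<phi> \<and>\<^sub>f Q n ?k \<phi>) \<in> x" for x
  proof (rule ccontr)
    assume "Dia j \<chi> \<notin> x"
    then have "Box j (Neg \<chi>) \<in> x"
      using x by (simp add: mcs_simps)
    obtain y where y: "mcs y" and succ: "\<And>\<psi>. Box j \<psi> \<in> x \<Longrightarrow> \<psi> \<in> y"
      and "\<phi> \<and>\<^sub>f Q n ?k \<phi> \<in> y"
      using mcs_Dia_successor[OF x d] by blast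
    then have "Q n ?k \<phi> \<in> y"
      by (simp add: mcs_simps del: Q.simps)
    moreover have "card {\<psi> \<in> D. Box n \<psi> \<notin> y} < ?k"
      using card_mono[OF D, of "{\<psi> \<in> D. Box n \<psi> \<notin> y}"] by fastforce
    ultimately obtain t where t: "mcs t" "\<forall>\<psi>. Box n \<psi> \<in> y \<longrightarrow> Box n \<psi> \<in> t \<and> \<psi> \<in> t" "\<phi> \<in> t"
      and refl: "\<forall>\<psi>\<in>D. Box n \<psi> \<in> t \<longrightarrow> \<psi> \<in> t"
      by (elim exE[OF Q_reflecting_successor[OF D y]] conjE)
    have "Box j (Neg \<chi>) \<in> y"
      using succ mcs_Box_trans[OF x \<open>Box j (Neg \<chi>) \<in> x\<close>] by blast
    \<comment> \<open>\<open>t\<close> is reached by level \<open>n\<close>, so the box is first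
      doubled at level \<open>j\<close> and its outer copy raised to \<open>n\<close>.\<close>
    then have "Box n (Box j (Neg \<chi>)) \<in> y"
      using mcs_Box_mono[OF y \<open>j \<le> n\<close>] mcs_Box_trans[OF y] by blast
    then have "Box j (Neg \<chi>) \<in> t"
      using t by blast
    \<comment> \<open>At the new point \<open>Dia (Suc n) \<phi>\<close> holds because
      \<open>t\<close> contains \<open>\<phi>\<close>, while \<open>Dia j \<chi>\<close> fails
      because boxes of level \<open>j\<close> are read off \<open>t\<close>.\<close>
    then show False
      using sound[OF t(1) refl] t \<open>j \<le> n\<close> by (simp add: above_Box mcs_simps)
  qed
  then have "GLP (Dia j (\<phi> \<and>\<^sub>f Q n ?k \<phi>) \<rightarrow>\<^sub>f Dia j \<chi>)"
    using GLP_iff_mcs mcs_Imp by blast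
  then show ?thesis by blast
qed

section \<open>Both directions of the equivalence\<close>

lemma derives_iff_mcs:
  "\<tau> \<turnstile> \<chi> \<longleftrightarrow> (\<exists>\<phi>s. set \<phi>s \<subseteq> \<tau> \<and> (\<forall>x. mcs x \<longrightarrow> set \<phi>s \<subseteq> x \<longrightarrow> \<chi> \<in> x))"
  unfolding derives_def GLP_iff_mcs by (simp add: mcs_Imp mcs_conj_list)

theorem theorem6:
  fixes j n :: nat and \<phi> :: fm
  assumes "j \<le> n"
  shows "equiv_dia j {Dia (n + 1) \<phi>} {Dia j (\<phi> \<and>\<^sub>f Q n k \<phi>) | k. True}"
  unfolding equiv_dia_def
proof (intro allI iffI)
  fix \<chi>
  assume "{Dia (n + 1) \<phi>} \<turnstile> Dia j \<chi>"
  then have "GLP (Dia (Suc n) \<phi> \<rightarrow>\<^sub>f Dia j \<chi>)"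
    unfolding derives_iff_mcs GLP_iff_mcs using mcs_Imp by fastforce
  then obtain k where "GLP (Dia j (\<phi> \<and>\<^sub>f Q n k \<phi>) \<rightarrow>\<^sub>f Dia j \<chi>)"
    using Dia_Suc_reduction[OF assms] by blast
  then show "{Dia j (\<phi> \<and>\<^sub>f Q n k \<phi>) | k. True} \<turnstile> Dia j \<chi>"
    unfolding derives_iff_mcs GLP_iff_mcs
    by (intro exI[of _ "[Dia j (\<phi> \<and>\<^sub>f Q n k \<phi>)]"]) (auto simp: mcs_Imp)
next
  fix \<chi>
  assume "{Dia j (\<phi> \<and>\<^sub>f Q n k \<phi>) | k. True} \<turnstile> Dia j \<chi>"
  then obtain \<phi>s where "set \<phi>s \<subseteq> {Dia j (\<phi> \<and>\<^sub>f Q n k \<phi>) | k. True}"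
    and "\<And>x. mcs x \<Longrightarrow> set \<phi>s \<subseteq> x \<Longrightarrow> Dia j \<chi> \<in> x"
    unfolding derives_iff_mcs by blast
  \<comment> \<open>Every member of the right-hand set follows from
    \<open>Dia (n + 1) \<phi>\<close>: insert \<open>Q n k \<phi>\<close> at level
    \<open>n + 1\<close>, then lower the diamond to \<open>j\<close>.\<close>
  moreover have "Dia j (\<phi> \<and>\<^sub>f Q n k \<phi>) \<in> x" if "mcs x" "Dia (n + 1) \<phi> \<in> x" for x k
    using mcs_Dia_mono[OF that(1) _ mcs_Dia_Suc_Q[OF that(1)]] that(2) assms by simp
  ultimately have "\<forall>x. mcs x \<longrightarrow> set [Dia (n + 1) \<phi>] \<subseteq> x \<longrightarrow> Dia j \<chi> \<in> x"
    by (auto simp del: One_nat_def) blast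
  then show "{Dia (n + 1) \<phi>} \<turnstile> Dia j \<chi>"
    unfolding derives_iff_mcs by (intro exI[of _ "[Dia (n + 1) \<phi>]"]) auto
qed

end
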